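(* For $n\ge 2$, let $P_n$ be the path on vertices $v_1,\dots,v_n$ with edges $v_iv_{i+1}$ ($1\le i\le n-1$), and let $E_n$ (resp. $O_n$) be the graph obtained from $P_n$ by attaching one pendant vertex $\ell_i$ (adjacent only to $v_i$) to each vertex $v_i$ with $i$ even (resp. $i$ odd). Let $\varphi=(1+\sqrt5)/2$ be the golden ratio. Then $$\zeta(E_n)\asymp \varphi^{\gamma(E_n)}\quad\text{and}\quad \zeta(O_n)\asymp\varphi^{\gamma(O_n)},$$ that is, there exist constants $0<c\le C$ such that for all $n\ge 2$, $c\,\varphi^{\gamma(E_n)}\le \zeta(E_n)\le C\,\varphi^{\gamma(E_n)}$ and $c\,\varphi^{\gamma(O_n)}\le \zeta(O_n)\le C\,\varphi^{\gamma(O_n)}$.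
   Context: For a finite simple graph $G$, a set $D\subseteq V(G)$ is dominating if every vertex of $G$ lies in $D$ or has a neighbor in $D$. The domination number $\gamma(G)$ is the minimum size of a dominating set. The dominion $\zeta(G)$ is the number of dominating sets of $G$ of size $\gamma(G)$. *)

theory Defs
  imports Complex_Main "Graph_Theory.Pair_Digraph"
begin

text \<open>
  Finite simple graphs are those \<open>G :: 'a pair_pre_digraph\<close> with \<^locale>\<open>pair_graph\<close>: finite,
  loop-free, and with a symmetric arc relation, each undirected edge being stored as
  its two orientations. Only for these are the following definitions intended.
\<close>

definition dominating_set :: "'a pair_pre_digraph \<Rightarrow> 'a set \<Rightarrow> bool" where
  "dominating_set G D \<longleftrightarrow>
     D \<subseteq> pverts G \<and> (\<forall>v \<in> pverts G. v \<in> D \<or> (\<exists>u \<in> D. (v, u) \<in> parcs G))"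

definition domination_number :: "'a pair_pre_digraph \<Rightarrow> nat" where
  "domination_number G = Min (card ` {D. dominating_set G D})"

definition dominion :: "'a pair_pre_digraph \<Rightarrow> nat" where
  "dominion G = card {D. dominating_set G D \<and> card D = domination_number G}"

definition path_graph :: "nat \<Rightarrow> nat pair_pre_digraph" where
  "path_graph n = \<lparr> pverts = {1..n},
     parcs = (\<Union>i \<in> {1..<n}. {(i, i + 1), (i + 1, i)}) \<rparr>"

text \<open>
  The vertex \<open>v\<close> of \<open>G\<close> becomes \<^term>\<open>Inl v\<close>; the pendant vertex attached to \<open>v \<in> S\<close>
  is \<^term>\<open>Inr v\<close>.
\<close>

definition attach_pendants :: "'a pair_pre_digraph \<Rightarrow> 'a set \<Rightarrow> ('a + 'a) pair_pre_digraph" where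
  "attach_pendants G S = \<lparr> pverts = Inl ` pverts G \<union> Inr ` S,
     parcs = (\<Union>(u, v) \<in> parcs G. {(Inl u, Inl v)})
           \<union> (\<Union>v \<in> S. {(Inl v, Inr v), (Inr v, Inl v)}) \<rparr>"

definition E_graph :: "nat \<Rightarrow> (nat + nat) pair_pre_digraph" where
  "E_graph n = attach_pendants (path_graph n) {i \<in> {1..n}. even i}"

definition O_graph :: "nat \<Rightarrow> (nat + nat) pair_pre_digraph" where
  "O_graph n = attach_pendants (path_graph n) {i \<in> {1..n}. odd i}"

definition golden_ratio :: real where
  "golden_ratio = (1 + sqrt 5) / 2"

lemma pair_graph_path_graph: "pair_graph (path_graph n)"
  by unfold_locales (auto simp: path_graph_def symmetric_def arcs_ends_def
      arc_to_ends_def with_proj_def sym_def)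

lemma pair_graph_attach_pendants:
  assumes "pair_graph G" "S \<subseteq> pverts G"
  shows "pair_graph (attach_pendants G S)"
proof -
  interpret pair_graph G by fact
  have fin: "finite S"
    using assms(2) pair_finite_verts finite_subset by blast
  have sym: "(v, u) \<in> parcs G" if "(u, v) \<in> parcs G" for u v
    using that pair_sym_arcs by (auto simp: symmetric_def sym_def)
  have irr: "(u, u) \<notin> parcs G" for u
    using pair_no_loops[of "(u, u)"] by auto
  have wf: "u \<in> pverts G" "v \<in> pverts G" if "(u, v) \<in> parcs G" for u v
    using that arc_fst_in_verts[of "(u, v)"] arc_snd_in_verts[of "(u, v)"] by auto
  show ?thesis
    by unfold_locales
      (use assms(2) fin pair_finite_verts pair_finite_arcs in
        \<open>auto simp: attach_pendants_def symmetric_def arcs_ends_def arc_to_ends_def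
          with_proj_def sym_def irr dest: wf sym\<close>)
qed

lemma pair_graph_E_graph: "pair_graph (E_graph n)"
  unfolding E_graph_def
  by (rule pair_graph_attach_pendants[OF pair_graph_path_graph]) (auto simp: path_graph_def)

lemma pair_graph_O_graph: "pair_graph (O_graph n)"
  unfolding O_graph_def
  by (rule pair_graph_attach_pendants[OF pair_graph_path_graph]) (auto simp: path_graph_def)

end

theory Submission
  imports Defs "HOL-Number_Theory.Fib"
begin

text \<open>
  Each support vertex and its leaf form a pair that every dominating set must meet, so a minimum
  dominating set picks exactly one vertex of each pair. Such a choice dominates if and only if every
  unsupported path vertex has a chosen neighbour. Numbering the \<open>k\<close> support vertices along the
  path, this says that no two consecutive ones are unchosen, and possibly that the first or the last
  one is chosen. Whatever the end conditions, the number of choices lies between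
  \<open>fib k\<close> and \<open>fib (k + 2)\<close>, and \<open>k\<close> is the domination number.
\<close>

section \<open>Minimum dominating sets of a graph with pendant vertices\<close>

lemma dominating_set_attach_pendants_iff:
  "dominating_set (attach_pendants G S) D \<longleftrightarrow>
     D \<subseteq> Inl ` pverts G \<union> Inr ` S \<and>
     (\<forall>v\<in>pverts G. Inl v \<in> D \<or> (\<exists>u. Inl u \<in> D \<and> (v, u) \<in> parcs G) \<or> (v \<in> S \<and> Inr v \<in> D)) \<and>
     (\<forall>v\<in>S. Inr v \<in> D \<or> Inl v \<in> D)"
  unfolding dominating_set_def attach_pendants_def
  by (simp add: ball_Un Bex_def split_beta) blast

text \<open>The map \<open>case_sum id id\<close> collapses each support vertex and its leaf to one
  point. Since a leaf can be dominated only by itself or by its support, no point of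
  \<open>S\<close> is missed.\<close>

lemma support_subset_image_dominating:
  assumes "dominating_set (attach_pendants G S) D"
  shows "S \<subseteq> case_sum id id ` D"
proof
  fix x assume "x \<in> S"
  then have "Inr x \<in> D \<or> Inl x \<in> D"
    using assms unfolding dominating_set_attach_pendants_iff by blast
  then show "x \<in> case_sum id id ` D" by force
qed

lemma attach_pendants_card_support_le:
  assumes "finite (pverts G)" "S \<subseteq> pverts G" "dominating_set (attach_pendants G S) D"
  shows "finite D" "card S \<le> card D"
proof -
  have "finite S" using assms finite_subset by blast
  then show "finite D"
    using assms unfolding dominating_set_attach_pendants_iff
    by (meson finite_Un finite_imageI finite_subset)
  then show "card S \<le> card D"
    using support_subset_image_dominating[OF assms(3)]
    by (meson surj_card_le)
qed

text \<open>With exactly \<open>card S\<close> vertices, \<open>D\<close> has one vertex in each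
  pair and none elsewhere, so it is determined by the set \<open>T\<close> of supports it uses. Each
  pair then dominates itself, and only the vertices outside \<open>S\<close> impose a condition on
  \<open>T\<close>.\<close>

lemma attach_pendants_minimum_sets:
  assumes fin: "finite (pverts G)" and S: "S \<subseteq> pverts G"
  shows "{D. dominating_set (attach_pendants G S) D \<and> card D = card S} =
    (\<lambda>T. Inl ` T \<union> Inr ` (S - T)) `
      {T. T \<subseteq> S \<and> (\<forall>v \<in> pverts G - S. \<exists>u \<in> T. (v, u) \<in> parcs G)}"
    (is "?L = ?F ` ?R")
proof (intro equalityI subsetI)
  fix D assume "D \<in> ?L"
  then have D: "dominating_set (attach_pendants G S) D" "card D = card S" by auto
  let ?h = "case_sum id id :: 'a + 'a \<Rightarrow> 'a"
  have finD: "finite D" using attach_pendants_card_support_le(1)[OF fin S D(1)] .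
  \<comment> \<open>Collapsing cannot increase the size, and the image already contains
    \<open>S\<close>. So the image is exactly \<open>S\<close> and no two vertices of
    \<open>D\<close> are collapsed together.\<close>
  have "card (?h ` D) \<le> card S" using card_image_le[OF finD] D(2) by metis
  then have img: "?h ` D = S"
    using support_subset_image_dominating[OF D(1)] finD by (metis card_seteq finite_imageI)
  then have inj: "inj_on ?h D"
    using finD D(2) by (simp add: eq_card_imp_inj_on)
  define T where "T = Inl -` D"
  have TS: "T \<subseteq> S" using img by (force simp: T_def)
  have disj: "\<not> (Inl x \<in> D \<and> Inr x \<in> D)" for x
    using inj_onD[OF inj, of "Inl x" "Inr x"] by auto
  have "D = ?F T"
  proof (intro equalityI subsetI)
    fix x assume "x \<in> D"
    moreover from this have "?h x \<in> S" using img by blast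
    ultimately show "x \<in> ?F T" using disj by (cases x) (auto simp: T_def)
  next
    fix x assume "x \<in> ?F T"
    then show "x \<in> D"
      using D(1) unfolding dominating_set_attach_pendants_iff by (auto simp: T_def)
  qed
  moreover have "T \<in> ?R"
    using TS D(1) unfolding dominating_set_attach_pendants_iff T_def by blast
  ultimately show "D \<in> ?F ` ?R" by blast
next
  fix D assume "D \<in> ?F ` ?R"
  then obtain T where T: "D = ?F T" "T \<subseteq> S" "\<forall>v \<in> pverts G - S. \<exists>u \<in> T. (v, u) \<in> parcs G"
    by auto
  have finS: "finite S" using fin S finite_subset by blast
  then have finT: "finite T" using T(2) finite_subset by blast
  have "card D = card T + card (S - T)"
    unfolding T(1) using finS finT
    by (subst card_Un_disjoint) (auto simp: card_image)
  then have card: "card D = card S"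
    using T(2) finS finT by (simp add: card_Diff_subset card_mono)
  have mem: "Inl x \<in> D \<longleftrightarrow> x \<in> T" "Inr x \<in> D \<longleftrightarrow> x \<in> S \<and> x \<notin> T" for x
    by (auto simp: T(1))
  have "dominating_set (attach_pendants G S) D"
    unfolding dominating_set_attach_pendants_iff
  proof (intro conjI ballI)
    show "D \<subseteq> Inl ` pverts G \<union> Inr ` S"
      unfolding T(1) using T(2) S by (intro Un_mono image_mono) auto
  next
    fix v assume v: "v \<in> pverts G"
    show "Inl v \<in> D \<or> (\<exists>u. Inl u \<in> D \<and> (v, u) \<in> parcs G) \<or> v \<in> S \<and> Inr v \<in> D"
    proof (cases "v \<in> S")
      case True
      then show ?thesis using mem by auto
    next
      case False
      then obtain u where "u \<in> T" "(v, u) \<in> parcs G" using T(3) v by blast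
      then show ?thesis using mem by auto
    qed
  qed (use mem in auto)
  with card show "D \<in> ?L" by simp
qed

text \<open>The hypothesis \<open>dom\<close> says that the choice \<open>T = S\<close> dominates,
  so the lower bound \<open>card S\<close> is attained. Minimum dominating sets then correspond
  bijectively to the admissible \<open>T\<close>, recovered as the preimage of \<open>D\<close>
  under \<open>Inl\<close>.\<close>

lemma
  assumes fin: "finite (pverts G)" and S: "S \<subseteq> pverts G"
    and dom: "\<And>v. v \<in> pverts G - S \<Longrightarrow> \<exists>u \<in> S. (v, u) \<in> parcs G"
  shows domination_number_attach_pendants:
      "domination_number (attach_pendants G S) = card S" (is ?number)
    and dominion_attach_pendants:
      "dominion (attach_pendants G S) =
        card {T. T \<subseteq> S \<and> (\<forall>v \<in> pverts G - S. \<exists>u \<in> T. (v, u) \<in> parcs G)}" (is ?dominion)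
proof -
  let ?H = "attach_pendants G S"
  have "finite S" using fin S finite_subset by blast
  then have "{D. dominating_set ?H D} \<subseteq> Pow (Inl ` pverts G \<union> Inr ` S)"
    "finite (Inl ` pverts G \<union> Inr ` S)"
    using fin by (auto simp: dominating_set_attach_pendants_iff)
  then have finD: "finite {D. dominating_set ?H D}"
    by (meson finite_Pow_iff finite_subset)
  have "Inl ` S \<union> Inr ` (S - S) \<in> {D. dominating_set ?H D \<and> card D = card S}"
    unfolding attach_pendants_minimum_sets[OF fin S] using dom by blast
  then show num: ?number
    unfolding domination_number_def using finD attach_pendants_card_support_le(2)[OF fin S]
    by (intro Min_eqI) (auto intro: rev_image_eqI)
  have "inj (\<lambda>T. Inl ` T \<union> Inr ` (S - T))"
    by (rule inj_on_inverseI[where g = "\<lambda>D. Inl -` D"]) auto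
  then show ?dominion
    unfolding dominion_def num attach_pendants_minimum_sets[OF fin S]
    by (intro card_image) (auto intro: inj_on_subset)
qed

section \<open>Counting sets without two consecutive gaps\<close>

text \<open>These are the vertex covers of the path \<open>0, ..., k - 1\<close>. The indices number
  the support vertices, and a pair \<open>i, Suc i\<close> stands for the two neighbours of one
  unsupported vertex.\<close>

definition gapless :: "nat \<Rightarrow> nat set set" where
  "gapless k = {T. T \<subseteq> {..<k} \<and> (\<forall>i. Suc i < k \<longrightarrow> i \<in> T \<or> Suc i \<in> T)}"

lemma finite_gapless: "finite (gapless k)"
  by (rule finite_subset[of _ "Pow {..<k}"]) (auto simp: gapless_def)

text \<open>Split on the last index. If \<open>Suc k\<close> is in \<open>T\<close>, the rest is any
  gapless set below \<open>Suc k\<close>; otherwise \<open>k\<close> is forced, and the part below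
  \<open>k\<close> is arbitrary.\<close>

lemma gapless_Suc_Suc:
  "gapless (Suc (Suc k)) = insert (Suc k) ` gapless (Suc k) \<union> insert k ` gapless k"
proof (intro equalityI subsetI)
  fix T assume T: "T \<in> gapless (Suc (Suc k))"
  show "T \<in> insert (Suc k) ` gapless (Suc k) \<union> insert k ` gapless k"
  proof (cases "Suc k \<in> T")
    case True
    then have "T = insert (Suc k) (T - {Suc k})" by blast
    moreover have "T - {Suc k} \<in> gapless (Suc k)"
      using T by (fastforce simp: gapless_def)
    ultimately show ?thesis by blast
  next
    case False
    then have "k \<in> T" using T by (auto simp: gapless_def)
    then have "T = insert k (T - {k})" by blast
    moreover have "T - {k} \<in> gapless k"
      using T False by (fastforce simp: gapless_def less_Suc_eq)
    ultimately show ?thesis by blast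
  qed
next
  fix T assume "T \<in> insert (Suc k) ` gapless (Suc k) \<union> insert k ` gapless k"
  then show "T \<in> gapless (Suc (Suc k))"
    by (auto simp: gapless_def less_Suc_eq)
qed

lemma card_gapless: "card (gapless k) = fib (k + 2)"
proof (induction k rule: fib.induct)
  case 1
  have "gapless 0 = {{}}" by (auto simp: gapless_def)
  then show ?case by (simp add: numeral_2_eq_2)
next
  case 2
  have "gapless (Suc 0) = {{}, {0}}" by (auto simp: gapless_def)
  then show ?case by (simp add: numeral_2_eq_2)
next
  case (3 k)
  \<comment> \<open>Members of \<open>gapless j\<close> lie below \<open>j\<close>, so the inserted
    element can be removed again. The two families are disjoint because only the first contains
    \<open>Suc k\<close> in its members.\<close>
  have "inj_on (insert j) (gapless j)" for j
    by (rule inj_on_inverseI[where g = "\<lambda>T. T - {j}"]) (auto simp: gapless_def)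
  moreover have "insert (Suc k) ` gapless (Suc k) \<inter> insert k ` gapless k = {}"
    by (auto simp: gapless_def)
  ultimately show ?case
    using 3 by (simp add: gapless_Suc_Suc card_Un_disjoint finite_gapless card_image)
qed

text \<open>Fixing both ends leaves \<open>k - 2\<close> interior indices, on which every gapless
  set is allowed. For \<open>k = 1\<close> the ends coincide and \<open>{0}\<close> is the only
  set.\<close>

lemma fib_le_card_gapless_ends:
  assumes "k > 0"
  shows "fib k \<le> card {T \<in> gapless k. 0 \<in> T \<and> k - 1 \<in> T}"
proof (cases "k = 1")
  case True
  then have "{T \<in> gapless k. 0 \<in> T \<and> k - 1 \<in> T} = {{0}}"
    by (auto simp: gapless_def)
  then show ?thesis using True by simp
next
  case False
  then obtain m where k: "k = Suc (Suc m)"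
    using assms by (cases k; cases "k - 1") auto
  \<comment> \<open>The interior set is shifted to the positions \<open>1, ..., m\<close>; the ends
    \<open>0\<close> and \<open>Suc m = k - 1\<close> are added.\<close>
  let ?f = "\<lambda>T. insert 0 (insert (Suc m) (Suc ` T))"
  have "inj_on ?f (gapless m)"
  proof (rule inj_onI)
    fix T U assume TU: "T \<in> gapless m" "U \<in> gapless m" "?f T = ?f U"
    \<comment> \<open>The bound \<open>i < m\<close> keeps the added end \<open>Suc m\<close> from
      being read as an interior element.\<close>
    have *: "i \<in> X \<longleftrightarrow> i < m \<and> Suc i \<in> ?f X" if "X \<in> gapless m" for i X
      using that by (auto simp: gapless_def)
    show "T = U"
      by (rule set_eqI) (simp only: *[OF TU(1)] *[OF TU(2)] TU(3))
  qed
  moreover have "?f ` gapless m \<subseteq> {T \<in> gapless k. 0 \<in> T \<and> k - 1 \<in> T}"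
  proof safe
    fix T assume T: "T \<in> gapless m"
    have "i \<in> ?f T \<or> Suc i \<in> ?f T" if "Suc i < k" for i
    proof (cases i)
      case (Suc j)
      \<comment> \<open>In the first case \<open>Suc i\<close> is the right end, the second is
        impossible since \<open>j < m\<close>, and in the third both indices are interior.\<close>
      then consider "j = m - 1" "m > 0" | "m = 0" | "Suc j < m" using \<open>Suc i < k\<close> k by linarith
      then show ?thesis using Suc T that by cases (auto simp: gapless_def k)
    qed simp
    then show "?f T \<in> gapless k"
      using T by (auto simp: gapless_def k)
  qed (auto simp: k)
  ultimately have "card (gapless m) \<le> card {T \<in> gapless k. 0 \<in> T \<and> k - 1 \<in> T}"
    by (intro card_inj_on_le) (auto simp: finite_gapless)
  then show ?thesis by (simp add: card_gapless k)
qed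

section \<open>Paths with pendants at every second vertex\<close>

lemma path_graph_simps:
  "pverts (path_graph n) = {1..n}"
  "(v, u) \<in> parcs (path_graph n) \<longleftrightarrow> v \<in> {1..n} \<and> u \<in> {1..n} \<and> (u = Suc v \<or> v = Suc u)"
  by (auto simp: path_graph_def)

text \<open>Here \<open>a\<close> is the first support, and the bounds on \<open>n\<close> say that
  the last one, \<open>2 * k + a - 2\<close>, lies on the path while \<open>2 * k + a\<close> does
  not. The admissible choices include all gapless sets containing both ends and are themselves
  gapless, which gives the two Fibonacci bounds.\<close>

lemma alternating_pendants:
  fixes a k n :: nat
  defines "S \<equiv> (\<lambda>j. 2 * j + a) ` {..<k}"
  assumes a: "a = 1 \<or> a = 2" and k: "k > 0" and n: "2 * k + a \<le> n + 2" "n < 2 * k + a"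
  shows "domination_number (attach_pendants (path_graph n) S) = k"
    and "fib k \<le> dominion (attach_pendants (path_graph n) S)"
    and "dominion (attach_pendants (path_graph n) S) \<le> fib (k + 2)"
proof -
  let ?G = "path_graph n"
  define f where "f = (\<lambda>j. 2 * j + a)"
  have S: "S = f ` {..<k}" by (simp add: S_def f_def)
  have inj: "inj f" by (auto simp: f_def inj_def)
  define R where "R = {T. T \<subseteq> S \<and> (\<forall>v \<in> pverts ?G - S. \<exists>u \<in> T. (v, u) \<in> parcs ?G)}"
  have SG: "S \<subseteq> pverts ?G" and fin: "finite (pverts ?G)"
    using a n by (auto simp: S_def path_graph_simps)
  \<comment> \<open>Every unsupported vertex is the right neighbour of some support, except vertex
    \<open>1\<close> when the first support is \<open>2\<close>.\<close>
  have unsupported: "(v = 1 \<and> a = 2) \<or> (\<exists>j<k. v = Suc (f j))" if "v \<in> pverts ?G - S" for v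
  proof (cases "v < a")
    case True
    then show ?thesis using that a by (auto simp: path_graph_simps)
  next
    case False
    define j where "j = (v - a) div 2"
    have "v = f j \<or> v = Suc (f j)" using False unfolding f_def j_def by linarith
    moreover have "j < k" using that n False by (auto simp: path_graph_simps j_def)
    ultimately show ?thesis using that by (auto simp: S)
  qed
  \<comment> \<open>Lower bound: choosing both end supports takes care of vertex \<open>1\<close>
    when \<open>a = 2\<close> and of a possible vertex to the right of the last support.\<close>
  have ends_mem: "f ` T \<in> R" if T: "T \<in> gapless k" "0 \<in> T" "k - 1 \<in> T" for T
  proof -
    have sub: "f ` T \<subseteq> S" using T by (auto simp: gapless_def S)
    have "\<exists>u \<in> f ` T. (v, u) \<in> parcs ?G" if v: "v \<in> pverts ?G - S" for v
      using unsupported[OF v]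
    proof (elim disjE exE conjE)
      assume "v = 1" "a = 2"
      then have "(v, f 0) \<in> parcs ?G" using k n by (auto simp: f_def path_graph_simps)
      then show ?thesis using T by blast
    next
      fix j assume j: "j < k" "v = Suc (f j)"
      show ?thesis
      proof (cases "j \<in> T")
        case True
        then have "(v, f j) \<in> parcs ?G"
            using a v j by (auto simp: path_graph_simps f_def)
        then show ?thesis using True by blast
      next
        case False
        then have "j \<noteq> k - 1" using T by auto
        then have "Suc j < k" using j by simp
        then have "Suc j \<in> T" using False T by (auto simp: gapless_def)
        moreover from this have "(v, f (Suc j)) \<in> parcs ?G"
          using \<open>Suc j < k\<close> a n v j by (auto simp: path_graph_simps f_def)
        ultimately show ?thesis by blast
      qed
    qed
    then show ?thesis using sub by (auto simp: R_def)
  qed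
  \<comment> \<open>Upper bound: the vertex between supports \<open>f i\<close> and
    \<open>f (Suc i)\<close> is unsupported by parity and has no other neighbours, so one of the two
    is chosen.\<close>
  have gap: "f -` T \<in> gapless k" if "T \<in> R" for T
  proof -
    have TS: "T \<subseteq> S" and T: "\<And>v. v \<in> pverts ?G - S \<Longrightarrow> \<exists>u \<in> T. (v, u) \<in> parcs ?G"
      using that by (auto simp: R_def)
    have "i \<in> f -` T \<or> Suc i \<in> f -` T" if i: "Suc i < k" for i
    proof -
      have "Suc (f i) \<notin> S" by (auto simp: S f_def) presburger
      then have "Suc (f i) \<in> pverts ?G - S"
        using i n by (auto simp: path_graph_simps f_def)
      from T[OF this] show ?thesis by (auto simp: path_graph_simps f_def)
    qed
    moreover have "f -` T \<subseteq> {..<k}" using TS inj by (auto simp: S inj_def)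
    ultimately show ?thesis by (auto simp: gapless_def)
  qed
  have "{..<k} \<in> gapless k" by (auto simp: gapless_def)
  \<comment> \<open>Choosing all supports is admissible, which is the hypothesis for computing the
    domination number.\<close>
  then have "S \<in> R" using ends_mem[of "{..<k}"] k by (simp add: S)
  then have dom: "\<And>v. v \<in> pverts ?G - S \<Longrightarrow> \<exists>u \<in> S. (v, u) \<in> parcs ?G"
    by (simp add: R_def)
  have "card S = k" unfolding S using inj by (simp add: card_image inj_on_subset)
  then show "domination_number (attach_pendants ?G S) = k"
    using domination_number_attach_pendants[OF fin SG dom] by simp
  have card: "dominion (attach_pendants ?G S) = card R"
    unfolding R_def by (rule dominion_attach_pendants[OF fin SG dom])
  have "finite R" unfolding R_def S by simp
  have "card {T \<in> gapless k. 0 \<in> T \<and> k - 1 \<in> T} \<le> card R"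
  proof (rule card_inj_on_le)
    show "inj_on ((`) f) {T \<in> gapless k. 0 \<in> T \<and> k - 1 \<in> T}"
      using inj by (simp add: inj_on_def inj_image_eq_iff)
    show "(`) f ` {T \<in> gapless k. 0 \<in> T \<and> k - 1 \<in> T} \<subseteq> R"
      using ends_mem by blast
  qed fact
  then show "fib k \<le> dominion (attach_pendants ?G S)"
    using fib_le_card_gapless_ends[OF k] card by linarith
  have "card R \<le> card (gapless k)"
  proof (rule card_inj_on_le)
    show "inj_on ((-`) f) R"
    proof (rule inj_onI)
      fix T U assume TU: "T \<in> R" "U \<in> R" "f -` T = f -` U"
      then have "T \<subseteq> range f" "U \<subseteq> range f" by (auto simp: R_def S)
      then show "T = U" using TU(3) by (metis image_vimage_eq inf.absorb1)
    qed
    show "(-`) f ` R \<subseteq> gapless k" using gap by blast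
  qed (rule finite_gapless)
  then show "dominion (attach_pendants ?G S) \<le> fib (k + 2)"
    by (simp only: card card_gapless)
qed

section \<open>Fibonacci numbers and powers of the golden ratio\<close>

lemma golden_ratio_gt_1: "golden_ratio > 1"
  by (simp add: golden_ratio_def real_less_rsqrt)

text \<open>The powers obey the Fibonacci recurrence, so comparing them with \<open>fib\<close>
  reduces to the first two indices.\<close>

lemma golden_ratio_power_Suc_Suc:
  "golden_ratio ^ Suc (Suc n) = golden_ratio ^ Suc n + golden_ratio ^ n"
proof -
  have "golden_ratio * golden_ratio = golden_ratio + 1"
    by (simp add: golden_ratio_def field_simps)
  then show ?thesis by (simp add: algebra_simps flip: mult.assoc)
qed

lemma fib_le_golden_ratio_power: "real (fib n) \<le> golden_ratio ^ n"
proof (induction n rule: fib.induct)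
  case (3 n)
  then show ?case unfolding golden_ratio_power_Suc_Suc fib.simps by simp
qed (use golden_ratio_gt_1 in auto)

text \<open>The index is shifted because \<open>fib 0 = 0\<close>. The factor
  \<open>golden_ratio\<close> is the smallest possible: equality holds at
  \<open>n = 1\<close>.\<close>

lemma golden_ratio_power_le_fib: "golden_ratio ^ n \<le> golden_ratio * real (fib (Suc n))"
proof (induction n rule: fib.induct)
  case (3 n)
  then show ?case unfolding golden_ratio_power_Suc_Suc fib.simps(3)[of "Suc n"]
    by (simp add: algebra_simps)
qed (use golden_ratio_gt_1 in auto)

text \<open>The upper constant comes from the index shift in \<open>fib (k + 2)\<close>. For the
  lower one, \<open>fib k\<close> with \<open>k = Suc m\<close> loses one factor in passing from
  \<open>k\<close> to \<open>m\<close> and another in the bound on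
  \<open>golden_ratio ^ m\<close>.\<close>

lemma alternating_pendants_golden_ratio:
  fixes a k n :: nat
  defines "H \<equiv> attach_pendants (path_graph n) ((\<lambda>j. 2 * j + a) ` {..<k})"
  assumes "a = 1 \<or> a = 2" "k > 0" "2 * k + a \<le> n + 2" "n < 2 * k + a"
  shows "1 / golden_ratio ^ 2 * golden_ratio ^ domination_number H \<le> real (dominion H)"
    and "real (dominion H) \<le> golden_ratio ^ 2 * golden_ratio ^ domination_number H"
proof -
  note * = alternating_pendants[OF assms(2-5), folded H_def]
  obtain m where m: "k = Suc m" using \<open>k > 0\<close> by (cases k) auto
  have "golden_ratio ^ k \<le> golden_ratio ^ 2 * real (fib k)"
    using golden_ratio_power_le_fib[of m] golden_ratio_gt_1
    by (simp add: m power2_eq_square mult.assoc)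
  also have "\<dots> \<le> golden_ratio ^ 2 * real (dominion H)"
    using *(2) by (intro mult_left_mono) auto
  finally show "1 / golden_ratio ^ 2 * golden_ratio ^ domination_number H \<le> real (dominion H)"
    using golden_ratio_gt_1 unfolding *(1) by (simp add: field_simps)
  have "real (dominion H) \<le> golden_ratio ^ (k + 2)"
    using *(3) fib_le_golden_ratio_power[of "k + 2"] by linarith
  then show "real (dominion H) \<le> golden_ratio ^ 2 * golden_ratio ^ domination_number H"
    unfolding *(1) by (simp add: power2_eq_square ac_simps)
qed

section \<open>The even and odd support sets\<close>

lemma even_support_eq: "{i \<in> {1..n::nat}. even i} = (\<lambda>j. 2 * j + 2) ` {..<n div 2}"
proof (intro equalityI subsetI)
  fix i assume "i \<in> {i \<in> {1..n::nat}. even i}"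
  then show "i \<in> (\<lambda>j. 2 * j + 2) ` {..<n div 2}"
    by (intro image_eqI[of _ _ "i div 2 - 1"]) (auto elim!: evenE)
qed auto

lemma odd_support_eq: "{i \<in> {1..n::nat}. odd i} = (\<lambda>j. 2 * j + 1) ` {..<Suc n div 2}"
proof (intro equalityI subsetI)
  fix i assume "i \<in> {i \<in> {1..n::nat}. odd i}"
  then show "i \<in> (\<lambda>j. 2 * j + 1) ` {..<Suc n div 2}"
    by (intro image_eqI[of _ _ "i div 2"]) (auto elim!: oddE)
qed auto

theorem corollary9:
  shows "\<exists>c C :: real. 0 < c \<and> c \<le> C \<and>
    (\<forall>n::nat. n \<ge> 2 \<longrightarrow>
      c * golden_ratio ^ domination_number (E_graph n) \<le> real (dominion (E_graph n)) \<and>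
      real (dominion (E_graph n)) \<le> C * golden_ratio ^ domination_number (E_graph n) \<and>
      c * golden_ratio ^ domination_number (O_graph n) \<le> real (dominion (O_graph n)) \<and>
      real (dominion (O_graph n)) \<le> C * golden_ratio ^ domination_number (O_graph n))"
proof (rule exI[of _ "1 / golden_ratio ^ 2"], rule exI[of _ "golden_ratio ^ 2"],
    intro conjI allI impI)
  show "0 < 1 / golden_ratio ^ 2" using golden_ratio_gt_1 by simp
  have "1 \<le> golden_ratio ^ 2" using golden_ratio_gt_1 by (simp add: one_le_power)
  then have "1 / golden_ratio ^ 2 \<le> 1" using golden_ratio_gt_1 by (simp add: divide_le_eq)
  with \<open>1 \<le> golden_ratio ^ 2\<close> show "1 / golden_ratio ^ 2 \<le> golden_ratio ^ 2" by linarith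
next
  fix n :: nat assume n: "n \<ge> 2"
  \<comment> \<open>The graphs \<open>E_graph n\<close> and \<open>O_graph n\<close> are the
    instances \<open>a = 2\<close>, \<open>k = n div 2\<close> and \<open>a = 1\<close>,
    \<open>k = Suc n div 2\<close>; \<open>n \<ge> 2\<close> ensures that an even support
    exists.\<close>
  have even: "n div 2 > 0" "2 * (n div 2) + 2 \<le> n + 2" "n < 2 * (n div 2) + 2"
    and odd: "Suc n div 2 > 0" "2 * (Suc n div 2) + 1 \<le> n + 2" "n < 2 * (Suc n div 2) + 1"
    using n by linarith+
  note E = alternating_pendants_golden_ratio[OF disjI2[OF refl] even,
      folded even_support_eq E_graph_def]
  note O = alternating_pendants_golden_ratio[OF disjI1[OF refl] odd,
      folded odd_support_eq O_graph_def]
  show "1 / golden_ratio ^ 2 * golden_ratio ^ domination_number (E_graph n)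
      \<le> real (dominion (E_graph n))"
    "real (dominion (E_graph n)) \<le> golden_ratio ^ 2 * golden_ratio ^ domination_number (E_graph n)"
    "1 / golden_ratio ^ 2 * golden_ratio ^ domination_number (O_graph n)
      \<le> real (dominion (O_graph n))"
    "real (dominion (O_graph n)) \<le> golden_ratio ^ 2 * golden_ratio ^ domination_number (O_graph n)"
    using E O by simp_all
qed

end
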